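(* Let $(\Psi_n)_{n \in \mathbb{N}}$ be an enumeration of $\mathbb{Q}$ (without repetitions), and let $\preccurlyeq$ be the order on $\mathbb{Q}$ defined by $\Psi_i \preccurlyeq \Psi_j$ if and only if $i \leq j$. (1) Let $\chi_2$ be the coloring of the $2$-element subsets of $\mathbb{Q}$ defined, for $x_1 < x_2$, by $\chi_2(\{x_1,x_2\}) = 0$ if $x_2 \preccurlyeq x_1$, and $\chi_2(\{x_1,x_2\}) = 1$ if $x_1 \preccurlyeq x_2$. Then there exists no infinite subset of $\mathbb{Q}$ that is monochromatic for $\chi_2$ and contains its limit point. (2) Let $\chi_3$ be the coloring of the $3$-element subsets of $\mathbb{Q}$ defined, for $x_1 < x_2 < x_3$, by $\chi_3(\{x_1,x_2,x_3\}) = 0$ if $x_1 \preccurlyeq x_2$ and $x_3 \preccurlyeq x_2$, and $\chi_3(\{x_1,x_2,x_3\}) = 1$ otherwise. Then there exists no infinite subset of $\mathbb{Q}$ which contains its limit point and all of whose $3$-element subsets are colored $1$ by $\chi_3$; and there exists no subset of $\mathbb{Q}$ containing more than $3$ elements all of whose $3$-element subsets are colored $0$ by $\chi_3$.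
   Context: Here $<$ is the usual order on $\mathbb{Q}$ and limit points are taken with respect to the usual metric. A set $\Lambda$ "contains its limit point" if there is some $r \in \Lambda$ which is a limit point of $\Lambda$, i.e. for every $\epsilon>0$ there is $r_\epsilon \in \Lambda$ with $r_\epsilon \ne r$ and $|r_\epsilon - r| < \epsilon$. A set is monochromatic for a coloring of $k$-element subsets if all of its $k$-element subsets receive the same color. *)

theory Defs
  imports "HOL-Analysis.Analysis" "HOL-Library.Ramsey"
begin

definition enum_le :: "(nat \<Rightarrow> rat) \<Rightarrow> rat \<Rightarrow> rat \<Rightarrow> bool" where
  "enum_le \<Psi> x y \<longleftrightarrow> (\<exists>i j. x = \<Psi> i \<and> y = \<Psi> j \<and> i \<le> j)"

(* The type rat carries no topology in the library, so limit points are spelled out with the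
   usual metric; lemma limit_point_iff_islimpt relates this to islimpt on the reals. *)
definition limit_point :: "rat \<Rightarrow> rat set \<Rightarrow> bool" where
  "limit_point r \<Lambda> \<longleftrightarrow>
     (\<forall>\<epsilon>::real. \<epsilon> > 0 \<longrightarrow> (\<exists>q\<in>\<Lambda>. q \<noteq> r \<and> \<bar>real_of_rat q - real_of_rat r\<bar> < \<epsilon>))"

definition contains_limit_point :: "rat set \<Rightarrow> bool" where
  "contains_limit_point \<Lambda> \<longleftrightarrow> (\<exists>r\<in>\<Lambda>. limit_point r \<Lambda>)"

definition all_colored :: "('a set \<Rightarrow> nat) \<Rightarrow> nat \<Rightarrow> 'a set \<Rightarrow> nat \<Rightarrow> bool" where
  "all_colored f k \<Lambda> c \<longleftrightarrow> (\<forall>S\<in>nsets \<Lambda> k. f S = c)"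

definition monochromatic_set :: "('a set \<Rightarrow> nat) \<Rightarrow> nat \<Rightarrow> 'a set \<Rightarrow> bool" where
  "monochromatic_set f k \<Lambda> \<longleftrightarrow> (\<exists>c. all_colored f k \<Lambda> c)"

(* The colorings are total functions on sets, meaningful only on sets with exactly 2
   (resp. 3) elements; chi2_color_0, chi2_color_1, chi3_eq give their values there. *)
definition chi2 :: "(nat \<Rightarrow> rat) \<Rightarrow> rat set \<Rightarrow> nat" where
  "chi2 \<Psi> S = (if \<exists>x1 x2. S = {x1, x2} \<and> x1 < x2 \<and> enum_le \<Psi> x2 x1 then 0 else 1)"

definition chi3 :: "(nat \<Rightarrow> rat) \<Rightarrow> rat set \<Rightarrow> nat" where
  "chi3 \<Psi> S = (if \<exists>x1 x2 x3. S = {x1, x2, x3} \<and> x1 < x2 \<and> x2 < x3 \<and>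
                        enum_le \<Psi> x1 x2 \<and> enum_le \<Psi> x3 x2 then 0 else 1)"

lemma enum_le_iff:
  assumes "bij \<Psi>"
  shows "enum_le \<Psi> (\<Psi> i) (\<Psi> j) \<longleftrightarrow> i \<le> j"
  using bij_is_inj[OF assms] by (auto simp: enum_le_def inj_eq)

lemma limit_point_iff_islimpt:
  "limit_point r \<Lambda> \<longleftrightarrow> real_of_rat r islimpt (real_of_rat ` \<Lambda>)"
  by (auto simp: limit_point_def islimpt_approachable dist_real_def)

lemma chi2_color_0:
  assumes "x1 < x2" "enum_le \<Psi> x2 x1"
  shows "chi2 \<Psi> {x1, x2} = 0"
  using assms by (auto simp: chi2_def)

lemma chi2_color_1:
  assumes "bij \<Psi>" "x1 < x2" "enum_le \<Psi> x1 x2"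
  shows "chi2 \<Psi> {x1, x2} = 1"
proof -
  have "\<not> enum_le \<Psi> x2 x1"
    using assms by (metis bij_pointE enum_le_iff le_antisym order_less_irrefl)
  then show ?thesis
    using \<open>x1 < x2\<close> by (auto simp: chi2_def doubleton_eq_iff)
qed

lemma chi3_eq:
  assumes "x1 < x2" "x2 < x3"
  shows "chi3 \<Psi> {x1, x2, x3} = (if enum_le \<Psi> x1 x2 \<and> enum_le \<Psi> x3 x2 then 0 else 1)"
proof -
  have "y1 = x1 \<and> y2 = x2 \<and> y3 = x3"
    if "{x1, x2, x3} = {y1, y2, y3}" "y1 < y2" "y2 < y3" for y1 y2 y3
  proof -
    have "y1 \<in> {x1, x2, x3}" "y2 \<in> {x1, x2, x3}" "y3 \<in> {x1, x2, x3}"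
      unfolding that(1) by simp_all
    then show ?thesis
      using assms that(2,3) by auto
  qed
  then show ?thesis
    using assms unfolding chi3_def by (smt (verit))
qed

end

(* A set coloured 1 by chi3 has only finitely many points between any two of its elements x < z,
   since each of them is enumerated before the later of x and z; so no element can be a limit
   point. A chi2-monochromatic set is of this kind, because a triple coloured 0 by chi3 contains
   pairs of both chi2 colours. Of four points a < b < c < d with all triples coloured 0, the
   triples abc and bcd force b and c to be enumerated each before the other. *)
theory Submission
  imports Defs
begin

lemma nsets_2_mem:
  assumes "x \<in> A" "y \<in> A" "x \<noteq> y"
  shows "{x, y} \<in> nsets A 2"
  using assms by (simp add: nsets_def)

lemma nsets_3_mem:
  assumes "x \<in> A" "y \<in> A" "z \<in> A" "distinct [x, y, z]"
  shows "{x, y, z} \<in> nsets A 3"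
  using assms by (simp add: nsets_def)

lemma enum_le_linear:
  assumes "bij \<Psi>"
  shows "enum_le \<Psi> x y \<or> enum_le \<Psi> y x"
  using assms by (metis bij_pointE enum_le_iff linear)

lemma enum_le_antisym:
  assumes "bij \<Psi>" "enum_le \<Psi> x y" "enum_le \<Psi> y x"
  shows "x = y"
  using assms by (metis bij_pointE enum_le_iff le_antisym)

text \<open>The enumeration order has the type of the natural numbers, so its initial segments are
  finite; all finiteness of intervals below comes from here.\<close>

lemma finite_enum_le:
  assumes "bij \<Psi>"
  shows "finite {x. enum_le \<Psi> x y}"
proof -
  obtain j where "y = \<Psi> j"
    using assms by (metis bij_pointE)
  \<comment> \<open>\<open>enum_le\<close> only asserts that some indices exist; injectivity forces
    the index of \<open>y\<close> to be \<open>j\<close>.\<close>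
  then have "{x. enum_le \<Psi> x y} \<subseteq> \<Psi> ` {..j}"
    using bij_is_inj[OF assms] by (auto simp: enum_le_def inj_eq)
  then show ?thesis
    using finite_surj by blast
qed

text \<open>Passing to the reals turns \<open>r\<close> into an accumulation point, and every
  neighbourhood of such a point meets the set in infinitely many points.\<close>

lemma infinite_near_limit_point:
  assumes "limit_point r \<Lambda>" "a < r" "r < b"
  shows "infinite (\<Lambda> \<inter> {a<..<b})"
proof -
  let ?U = "{real_of_rat a<..<real_of_rat b}"
  have "infinite (real_of_rat ` \<Lambda> \<inter> ?U)"
  proof -
    have "real_of_rat r \<in> ?U" "open ?U"
      using assms(2,3) by (simp_all add: of_rat_less)
    then show ?thesis
      using assms(1) unfolding limit_point_iff_islimpt islimpt_eq_acc_point
      by (metis Int_commute)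
  qed
  moreover have "real_of_rat ` \<Lambda> \<inter> ?U = real_of_rat ` (\<Lambda> \<inter> {a<..<b})"
    by (auto simp: of_rat_less)
  ultimately show ?thesis
    by (metis finite_imageI)
qed

text \<open>On each side of \<open>r\<close> an element of \<open>\<Lambda>\<close> bounds a finite
  piece, or else there is no element on that side at all. Either way \<open>r\<close> has a
  neighbourhood containing finitely many elements.\<close>

lemma finite_between_no_limit_point:
  assumes "\<And>a b. a \<in> \<Lambda> \<Longrightarrow> b \<in> \<Lambda> \<Longrightarrow> a < b \<Longrightarrow> finite (\<Lambda> \<inter> {a<..<b})"
  shows "\<not> contains_limit_point \<Lambda>"
proof
  assume "contains_limit_point \<Lambda>"
  then obtain r where r: "r \<in> \<Lambda>" "limit_point r \<Lambda>"
    unfolding contains_limit_point_def by blast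
  have "\<exists>a<r. finite (\<Lambda> \<inter> {a<..<r})"
  proof (cases "\<exists>a\<in>\<Lambda>. a < r")
    case True
    then show ?thesis using assms r(1) by blast
  next
    case False
    \<comment> \<open>With no element below \<open>r\<close>, any rational below \<open>r\<close>
      would serve as left endpoint.\<close>
    then have "\<Lambda> \<inter> {r - 1<..<r} = {}" by auto
    then show ?thesis by (intro exI[of _ "r - 1"]) simp
  qed
  moreover have "\<exists>b>r. finite (\<Lambda> \<inter> {r<..<b})"
  proof (cases "\<exists>b\<in>\<Lambda>. r < b")
    case True
    then show ?thesis using assms r(1) by blast
  next
    case False
    then have "\<Lambda> \<inter> {r<..<r + 1} = {}" by auto
    then show ?thesis by (intro exI[of _ "r + 1"]) simp
  qed
  ultimately obtain a b where ab: "a < r" "r < b"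
    and fin: "finite (\<Lambda> \<inter> {a<..<r})" "finite (\<Lambda> \<inter> {r<..<b})"
    by blast
  have "\<Lambda> \<inter> {a<..<b} \<subseteq> insert r (\<Lambda> \<inter> {a<..<r} \<union> \<Lambda> \<inter> {r<..<b})"
    by auto
  then have "finite (\<Lambda> \<inter> {a<..<b})"
    using fin by (meson finite.insertI finite_UnI finite_subset)
  then show False
    using infinite_near_limit_point[OF r(2) ab] by blast
qed

lemma chi3_all_1_no_limit_point:
  assumes "bij \<Psi>" "all_colored (chi3 \<Psi>) 3 \<Lambda> 1"
  shows "\<not> contains_limit_point \<Lambda>"
proof (rule finite_between_no_limit_point)
  fix a b assume ab: "a \<in> \<Lambda>" "b \<in> \<Lambda>" "a < b"
  have "enum_le \<Psi> y a \<or> enum_le \<Psi> y b" if "y \<in> \<Lambda>" "a < y" "y < b" for y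
  proof -
    have "chi3 \<Psi> {a, y, b} = 1"
      using assms(2) ab that nsets_3_mem[of a \<Lambda> y b] by (auto simp: all_colored_def)
    then have "\<not> (enum_le \<Psi> a y \<and> enum_le \<Psi> b y)"
      using chi3_eq[OF that(2,3)] by (metis zero_neq_one)
    then show ?thesis
      using enum_le_linear[OF assms(1)] by blast
  qed
  then have "\<Lambda> \<inter> {a<..<b} \<subseteq> {y. enum_le \<Psi> y a} \<union> {y. enum_le \<Psi> y b}"
    by fastforce
  then show "finite (\<Lambda> \<inter> {a<..<b})"
    using finite_enum_le[OF assms(1)] by (meson finite_UnI finite_subset)
qed

text \<open>In a triple coloured 0 the enumeration rises to the middle point and then falls, so its
  left pair has \<open>chi2\<close> colour 1 and its right pair colour 0.\<close>

lemma chi2_monochromatic_chi3_all_1: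
  assumes "bij \<Psi>" "monochromatic_set (chi2 \<Psi>) 2 \<Lambda>"
  shows "all_colored (chi3 \<Psi>) 3 \<Lambda> 1"
  unfolding all_colored_def
proof
  fix S assume S: "S \<in> nsets \<Lambda> 3"
  show "chi3 \<Psi> S = 1"
  proof (rule ccontr)
    assume "chi3 \<Psi> S \<noteq> 1"
    then obtain x y z where xyz: "S = {x, y, z}" "x < y" "y < z"
      "enum_le \<Psi> x y" "enum_le \<Psi> z y"
      unfolding chi3_def by (auto split: if_splits)
    then have "{x, y} \<in> nsets \<Lambda> 2" "{y, z} \<in> nsets \<Lambda> 2"
      using S nsets_2_mem[of x \<Lambda> y] nsets_2_mem[of y \<Lambda> z] by (auto simp: nsets_def)
    then have "chi2 \<Psi> {x, y} = chi2 \<Psi> {y, z}"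
      using assms(2) by (auto simp: monochromatic_set_def all_colored_def)
    then show False
      using chi2_color_1[OF assms(1) xyz(2,4)] chi2_color_0[OF xyz(3,5)] by simp
  qed
qed

text \<open>Since \<open>card\<close> is 0 on infinite sets, having more than 3 elements is
  expressed by a disjunction.\<close>

lemma obtain_4_increasing:
  fixes A :: "'a::linorder set"
  assumes "infinite A \<or> card A > 3"
  obtains a b c d where "{a, b, c, d} \<subseteq> A" "a < b" "b < c" "c < d"
proof -
  obtain B where B: "B \<subseteq> A" "card B = 4" "finite B"
  proof (cases "finite A")
    case True
    then show ?thesis
      using assms obtain_subset_with_card_n[of 4 A] that by auto
  next
    case False
    then show ?thesis
      using infinite_arbitrarily_large that by blast
  qed
  define xs where "xs = sorted_list_of_set B"
  have "length xs = 4" "sorted_wrt (<) xs" "set xs = B"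
    using B by (simp_all add: xs_def)
  then obtain a b c d where "xs = [a, b, c, d]"
    by (auto simp: numeral_eq_Suc length_Suc_conv)
  then show thesis
    using \<open>sorted_wrt (<) xs\<close> \<open>set xs = B\<close> B(1) that[of a b c d] by auto
qed

lemma chi3_not_all_0:
  assumes "bij \<Psi>" "infinite \<Lambda> \<or> card \<Lambda> > 3"
  shows "\<not> all_colored (chi3 \<Psi>) 3 \<Lambda> 0"
proof
  assume all0: "all_colored (chi3 \<Psi>) 3 \<Lambda> 0"
  \<comment> \<open>Colour 0 makes the middle point the last of the three in the
    enumeration.\<close>
  have peak: "enum_le \<Psi> x y \<and> enum_le \<Psi> z y"
    if "{x, y, z} \<subseteq> \<Lambda>" "x < y" "y < z" for x y z
  proof -
    have "chi3 \<Psi> {x, y, z} = 0"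
      using all0 that nsets_3_mem[of x \<Lambda> y z] by (auto simp: all_colored_def)
    then show ?thesis
      using chi3_eq[OF that(2,3)] by (metis zero_neq_one)
  qed
  obtain a b c d where abcd: "{a, b, c, d} \<subseteq> \<Lambda>" "a < b" "b < c" "c < d"
    using obtain_4_increasing[OF assms(2)] .
  then have "enum_le \<Psi> c b" "enum_le \<Psi> b c"
    using peak[of a b c] peak[of b c d] by auto
  then show False
    using enum_le_antisym[OF assms(1)] \<open>b < c\<close> by blast
qed

theorem claim3p4:
  fixes \<Psi> :: "nat \<Rightarrow> rat"
  assumes "bij \<Psi>"
  shows "(\<nexists>\<Lambda>. infinite \<Lambda> \<and> monochromatic_set (chi2 \<Psi>) 2 \<Lambda> \<and> contains_limit_point \<Lambda>)
    \<and> (\<nexists>\<Lambda>. infinite \<Lambda> \<and> contains_limit_point \<Lambda> \<and> all_colored (chi3 \<Psi>) 3 \<Lambda> 1)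
    \<and> (\<nexists>\<Lambda>. (infinite \<Lambda> \<or> card \<Lambda> > 3) \<and> all_colored (chi3 \<Psi>) 3 \<Lambda> 0)"
  using chi3_all_1_no_limit_point[OF assms] chi2_monochromatic_chi3_all_1[OF assms]
    chi3_not_all_0[OF assms]
  by blast

end
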